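(* Let $\mathbf{N}=(N_1,N_2)\in\mathbb{Z}^2$, let $M\ge \mu(I^{\mathbf{N}})$ be an integer, and let $0\leq t_1<t_2<\dots<t_M<2\pi$. Then the matrix $\mathbf{H}=\bigl[e^{\mathrm{i}(N_1+k-1)t_p}\bigr]_{1\le k,p\le M}$ ($k$ the row index, $p$ the column index) is invertible, and every $f\in B_{\mathbf{N}}$ is exactly reconstructed from its $M$ samples by $$f(t)=\sum_{p=1}^{M}f(t_p)\,h_p(t)\qquad\text{for all }t,$$ where $h_p(t)=\sum_{k=1}^{M}z_p(k)e^{\mathrm{i}(k+N_1-1)t}$ and $z_p(k)$ is the $(p,k)$-th element of $\mathbf{H}^{-1}$. Moreover, for $1\le p\le M$, $$h_p(t)=e^{\mathrm{i}N_1(t-t_p)}\,e^{\frac{\mathrm{i}(M-1)(t-t_p)}{2}}\,\frac{\prod_{s=1,\,s\ne p}^{M}\sin\left(\frac{t-t_s}{2}\right)}{\prod_{s=1,\,s\ne p}^{M}\sin\left(\frac{t_p-t_s}{2}\right)} .$$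
   Context: Here $\mathrm{i}$ is the imaginary unit. For $\mathbf{N}=(N_1,N_2)\in\mathbb{Z}^2$ with $N_1\le N_2$, $I^{\mathbf{N}}=\{n\in\mathbb{Z}: N_1\le n\le N_2\}$, $\mu(I^{\mathbf{N}})=N_2-N_1+1$ is its cardinality, and $B_{\mathbf{N}}$ is the set of all functions of the form $f(t)=\sum_{n\in I^{\mathbf{N}}}a(n)e^{\mathrm{i}nt}$ with $a(n)\in\mathbb{C}$. *)

theory Defs
  imports "HOL-Analysis.Analysis" "Jordan_Normal_Form.Gauss_Jordan_Elimination"
begin

definition freq_interval :: "int \<times> int \<Rightarrow> int set" where
  "freq_interval N = {fst N..snd N}"

definition bandlimited :: "int \<times> int \<Rightarrow> (real \<Rightarrow> complex) set" where
  "bandlimited N =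
     {f. \<exists>a :: int \<Rightarrow> complex.
           f = (\<lambda>t. \<Sum>n\<in>freq_interval N. a n * exp (\<i> * of_int n * of_real t))}"

(* The sample points are t 1, ..., t M.  Library matrices are indexed from 0, so the mathematical
   (k, p) entry, with 1 <= k, p <= M, is the library entry (k - 1, p - 1). *)
definition sample_mat :: "int \<times> int \<Rightarrow> nat \<Rightarrow> (nat \<Rightarrow> real) \<Rightarrow> complex mat" where
  "sample_mat N M t =
     mat M M (\<lambda>(k, p). exp (\<i> * of_int (fst N + int (k + 1) - 1) * of_real (t (p + 1))))"

(* mat_inverse is option-valued: it is Some of the two-sided inverse for an invertible square
   matrix and None otherwise. *)
definition inv_coeff :: "int \<times> int \<Rightarrow> nat \<Rightarrow> (nat \<Rightarrow> real) \<Rightarrow> nat \<Rightarrow> nat \<Rightarrow> complex" where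
  "inv_coeff N M t p k = the (mat_inverse (sample_mat N M t)) $$ (p - 1, k - 1)"

definition recon_fun :: "int \<times> int \<Rightarrow> nat \<Rightarrow> (nat \<Rightarrow> real) \<Rightarrow> nat \<Rightarrow> real \<Rightarrow> complex" where
  "recon_fun N M t p x =
     (\<Sum>k = 1..M. inv_coeff N M t p k * exp (\<i> * of_int (int k + fst N - 1) * of_real x))"

end

(* Writing w_p = exp (i t_p), the sampling matrix is a Vandermonde matrix in the distinct nodes w_p
   with columns scaled by w_p ^ N_1, so its inverse is read off the coefficients of the Lagrange
   basis polynomials L_p at the w_p.  Hence h_p(x) = exp (i N_1 (x - t_p)) L_p(exp (i x)), and the
   closed form follows by factoring each exp (i a) - exp (i b) into a half-angle phase and a sine. *)

theory Submission
  imports Defs "Jordan_Normal_Form.Determinant"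
begin

section \<open>Lagrange basis polynomials over a field\<close>

definition lagrange_basis :: "'i set \<Rightarrow> ('i \<Rightarrow> 'a::field) \<Rightarrow> 'i \<Rightarrow> 'a poly" where
  "lagrange_basis S w p = (\<Prod>s\<in>S - {p}. Polynomial.smult (inverse (w p - w s)) [:- w s, 1:])"

lemma poly_lagrange_basis:
  "poly (lagrange_basis S w p) x = (\<Prod>s\<in>S - {p}. (x - w s) / (w p - w s))"
  by (simp add: lagrange_basis_def poly_prod divide_inverse algebra_simps)

lemma poly_lagrange_basis_node:
  assumes "finite S" "inj_on w S" "p \<in> S" "q \<in> S"
  shows "poly (lagrange_basis S w p) (w q) = (if p = q then 1 else 0)"
proof (cases "p = q")
  case True
  have "(w p - w s) / (w p - w s) = 1" if "s \<in> S - {p}" for s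
    using that assms by (auto simp: inj_on_def)
  with True show ?thesis
    by (simp add: poly_lagrange_basis)
next
  case False
  with assms have "\<exists>s\<in>S - {p}. (w q - w s) / (w p - w s) = 0"
    by (intro bexI[of _ q]) auto
  with False assms(1) show ?thesis
    by (simp add: poly_lagrange_basis prod_zero)
qed

lemma degree_lagrange_basis:
  assumes "finite S" "p \<in> S"
  shows "degree (lagrange_basis S w p) < card S"
proof -
  have "degree (lagrange_basis S w p)
      \<le> (\<Sum>s\<in>S - {p}. degree (Polynomial.smult (inverse (w p - w s)) [:- w s, 1:]))"
    unfolding lagrange_basis_def
    by (rule degree_prod_sum_le[unfolded o_def]) (use assms(1) in simp)
  also have "\<dots> \<le> (\<Sum>s\<in>S - {p}. 1)"
    by (intro sum_mono order_trans[OF degree_smult_le]) simp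
  also have "\<dots> < card S"
    using assms card_gt_0_iff[of S] by auto
  finally show ?thesis .
qed

text \<open>Padding with zero coefficients gives exactly \<open>n\<close> terms, and the shifted
  index matches the 1-based sum in \<open>recon_fun\<close>.\<close>

lemma poly_eq_sum_coeff_1:
  fixes p :: "'a::comm_semiring_1 poly"
  assumes "degree p < n"
  shows "poly p x = (\<Sum>k = 1..n. coeff p (k - 1) * x ^ (k - 1))"
proof -
  have "poly p x = (\<Sum>k<n. coeff p k * x ^ k)"
    unfolding poly_altdef using assms
    by (intro sum.mono_neutral_left) (auto simp: coeff_eq_0)
  also have "\<dots> = (\<Sum>k = 1..n. coeff p (k - 1) * x ^ (k - 1))"
    by (rule sum.reindex_bij_witness[of _ "\<lambda>k. k - 1" Suc]) auto
  finally show ?thesis .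
qed

section \<open>Products and inverses of matrices\<close>

lemma index_mult_mat_sum:
  assumes "A \<in> carrier_mat l m" "B \<in> carrier_mat m n" "i < l" "j < n"
  shows "(A * B) $$ (i, j) = (\<Sum>k<m. A $$ (i, k) * B $$ (k, j))"
  using assms by (simp add: scalar_prod_def atLeast0LessThan)

text \<open>Over a field, a left inverse of a square matrix is also a right inverse. This excludes
  \<open>None\<close>, and uniqueness of inverses identifies the result with
  \<open>B\<close>.\<close>

lemma mat_inverse_eqI:
  fixes A :: "'a::field mat"
  assumes A: "A \<in> carrier_mat n n" and B: "B \<in> carrier_mat n n" and BA: "B * A = 1\<^sub>m n"
  shows "mat_inverse A = Some B"
proof (cases "mat_inverse A")
  case None
  have "A * B = 1\<^sub>m n"
    by (rule mat_mult_left_right_inverse[OF B A BA])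
  with A B BA have "A \<in> Units (ring_mat TYPE('a) n undefined)"
    by (auto simp: Units_def ring_mat_def)
  with mat_inverse(1)[OF A None, of undefined] show ?thesis
    by blast
next
  case (Some C)
  from mat_inverse(2)[OF A Some] have C: "A * C = 1\<^sub>m n" "C \<in> carrier_mat n n"
    by auto
  have "B = B * (A * C)"
    using B C by simp
  also have "\<dots> = C"
    using assoc_mult_mat[OF B A C(2)] BA C(2) by simp
  finally show ?thesis
    using Some by simp
qed

section \<open>Points on the unit circle\<close>

lemma exp_ii_diff:
  "exp (\<i> * of_real a) - exp (\<i> * of_real b)
    = 2 * \<i> * exp (\<i> * of_real ((a + b) / 2)) * of_real (sin ((a - b) / 2))"
proof -
  \<comment> \<open>Read from right to left: with the phase of the midpoint factored out, what
    remains is exp(iu) - exp(-iu) = 2i sin u, where u is half of a - b.\<close>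
  have "2 * \<i> * exp (\<i> * of_real ((a + b) / 2)) * of_real (sin ((a - b) / 2))
      = exp (\<i> * of_real ((a + b) / 2)) * (2 * \<i> * sin (of_real ((a - b) / 2)))"
    by (simp only: sin_of_real mult_ac)
  also have "\<dots> = exp (\<i> * of_real ((a + b) / 2))
      * (exp (\<i> * of_real ((a - b) / 2)) - exp (- (\<i> * of_real ((a - b) / 2))))"
    by (simp add: sin_exp_eq)
  also have "\<dots> = exp (\<i> * of_real ((a + b) / 2) + \<i> * of_real ((a - b) / 2))
      - exp (\<i> * of_real ((a + b) / 2) + - (\<i> * of_real ((a - b) / 2)))"
    by (simp only: exp_add right_diff_distrib)
  also have "\<i> * of_real ((a + b) / 2) + \<i> * of_real ((a - b) / 2) = \<i> * of_real a"
    by (simp add: field_simps)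
  also have "\<i> * of_real ((a + b) / 2) + - (\<i> * of_real ((a - b) / 2)) = \<i> * of_real b"
    by (simp add: field_simps)
  finally show ?thesis ..
qed

text \<open>The factor 2i and the half phase of b cancel in the quotient. If sin((a - b)/2) = 0,
  both sides are 0 by the convention for division by zero.\<close>

lemma exp_ii_diff_divide:
  "(exp (\<i> * of_real x) - exp (\<i> * of_real b)) / (exp (\<i> * of_real a) - exp (\<i> * of_real b))
    = exp (\<i> * of_real (x - a) / 2) * of_real (sin ((x - b) / 2) / sin ((a - b) / 2))"
proof -
  have "\<i> * of_real ((x + b) / 2)
      = \<i> * of_real (x - a) / 2 + \<i> * of_real ((a + b) / 2)"
    by (simp add: field_simps)
  then have "exp (\<i> * of_real ((x + b) / 2))
      = exp (\<i> * of_real (x - a) / 2) * exp (\<i> * of_real ((a + b) / 2))"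
    by (simp only: exp_add)
  then show ?thesis
    by (simp only: exp_ii_diff) simp
qed

text \<open>Two points of a half-open interval of length 2 pi differ by less than the period of x
  \<mapsto> exp(ix).\<close>

lemma inj_on_exp_ii:
  assumes "t ` S \<subseteq> {0..<2 * pi}" "inj_on t S"
  shows "inj_on (\<lambda>s. exp (\<i> * complex_of_real (t s))) S"
proof (rule inj_onI)
  fix r s assume rs: "r \<in> S" "s \<in> S"
    and eq: "exp (\<i> * complex_of_real (t r)) = exp (\<i> * complex_of_real (t s))"
  from assms(1) rs have "t r \<in> {0..<2 * pi}" "t s \<in> {0..<2 * pi}"
    by blast+
  then have "\<bar>Im (\<i> * complex_of_real (t r)) - Im (\<i> * complex_of_real (t s))\<bar> < 2 * pi"
    by (auto simp: abs_if)
  from exp_complex_eqI[OF this eq] have "t r = t s"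
    by simp
  with assms(2) rs show "r = s"
    by (auto dest: inj_onD)
qed

section \<open>The sampling matrix and its explicit inverse\<close>

lemma exp_ii_of_int_add:
  "exp (\<i> * of_int (n + int k) * of_real x)
    = exp (\<i> * of_int n * of_real x) * exp (\<i> * of_real x) ^ k"
  by (simp add: exp_of_nat_mult[symmetric] exp_add[symmetric] algebra_simps)

text \<open>The sampling matrix is V D with V Vandermonde and D the diagonal matrix of the w_p ^
  N_1. In its inverse, D^-1 stands on the left and scales rows, so the phase depends on
  \<open>p\<close> alone.\<close>

definition sample_mat_inv :: "int \<times> int \<Rightarrow> nat \<Rightarrow> (nat \<Rightarrow> real) \<Rightarrow> complex mat" where
  "sample_mat_inv N M t = mat M M (\<lambda>(p, k).
     exp (- (\<i> * of_int (fst N) * of_real (t (p + 1))))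
       * coeff (lagrange_basis {1..M} (\<lambda>s. exp (\<i> * of_real (t s))) (p + 1)) k)"

lemma sample_mat_carrier [simp]: "sample_mat N M t \<in> carrier_mat M M"
  by (simp add: sample_mat_def)

lemma sample_mat_inv_carrier [simp]: "sample_mat_inv N M t \<in> carrier_mat M M"
  by (simp add: sample_mat_inv_def)

text \<open>Used twice: at a sample point x it computes an entry of the product with the sampling
  matrix, and at arbitrary x it evaluates \<open>recon_fun\<close>. It is therefore stated for
  \<open>sample_mat_inv\<close>, before this is known to be the inverse.\<close>

lemma sum_sample_mat_inv:
  assumes "p \<in> {1..M}"
  shows "(\<Sum>k = 1..M. sample_mat_inv N M t $$ (p - 1, k - 1)
            * exp (\<i> * of_int (int k + fst N - 1) * of_real x))
    = exp (\<i> * of_int (fst N) * of_real (x - t p))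
      * poly (lagrange_basis {1..M} (\<lambda>s. exp (\<i> * of_real (t s))) p) (exp (\<i> * of_real x))"
    (is "_ = ?E * poly ?L ?w")
proof -
  have "sample_mat_inv N M t $$ (p - 1, k - 1) * exp (\<i> * of_int (int k + fst N - 1) * of_real x)
      = ?E * (coeff ?L (k - 1) * ?w ^ (k - 1))" if k: "k \<in> {1..M}" for k
  proof -
    have "sample_mat_inv N M t $$ (p - 1, k - 1)
        = exp (- (\<i> * of_int (fst N) * of_real (t p))) * coeff ?L (k - 1)"
      using k assms by (cases p; cases k) (auto simp: sample_mat_inv_def)
    moreover have "int k + fst N - 1 = fst N + int (k - 1)"
      using k by simp
    then have "exp (\<i> * of_int (int k + fst N - 1) * of_real x)
        = exp (\<i> * of_int (fst N) * of_real x) * ?w ^ (k - 1)"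
      by (simp only: exp_ii_of_int_add)
    moreover have "?E = exp (- (\<i> * of_int (fst N) * of_real (t p)))
        * exp (\<i> * of_int (fst N) * of_real x)"
      by (simp add: exp_add[symmetric] algebra_simps)
    ultimately show ?thesis
      by (simp only: mult_ac)
  qed
  note summand = this
  have deg: "degree ?L < M"
    using degree_lagrange_basis[of "{1..M}" p] assms by simp
  show ?thesis
    unfolding poly_eq_sum_coeff_1[OF deg] sum_distrib_left by (rule sum.cong[OF refl summand])
qed

lemma sample_mat_inv_mult:
  assumes "inj_on (\<lambda>s. exp (\<i> * complex_of_real (t s))) {1..M}"
  shows "sample_mat_inv N M t * sample_mat N M t = 1\<^sub>m M"
proof (rule eq_matI)
  fix i j assume "i < dim_row (1\<^sub>m M :: complex mat)" "j < dim_col (1\<^sub>m M :: complex mat)"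
  then have ij: "i < M" "j < M"
    by auto
  have "(sample_mat_inv N M t * sample_mat N M t) $$ (i, j)
      = (\<Sum>k<M. sample_mat_inv N M t $$ (i, k) * sample_mat N M t $$ (k, j))"
    using ij by (intro index_mult_mat_sum) simp_all
  \<comment> \<open>The row is written \<open>Suc i - 1\<close> to match the 1-based form of
    \<open>sum_sample_mat_inv\<close>.\<close>
  also have "\<dots> = (\<Sum>k = 1..M. sample_mat_inv N M t $$ (Suc i - 1, k - 1)
            * exp (\<i> * of_int (int k + fst N - 1) * of_real (t (Suc j))))"
    using ij by (intro sum.reindex_bij_witness[of _ "\<lambda>k. k - 1" Suc])
      (auto simp: sample_mat_def algebra_simps)
  also have "\<dots> = 1\<^sub>m M $$ (i, j)"
    \<comment> \<open>Off the diagonal the Lagrange polynomial vanishes at the node; on it the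
      polynomial is 1 and the phase is exp 0.\<close>
    using ij by (subst sum_sample_mat_inv, simp) (subst poly_lagrange_basis_node[OF _ assms], auto)
  finally show "(sample_mat_inv N M t * sample_mat N M t) $$ (i, j) = 1\<^sub>m M $$ (i, j)" .
qed (use carrier_matD[OF sample_mat_carrier[of N M t]]
      carrier_matD[OF sample_mat_inv_carrier[of N M t]] in auto)

lemma sample_mat_mult_inv:
  assumes "inj_on (\<lambda>s. exp (\<i> * complex_of_real (t s))) {1..M}"
  shows "sample_mat N M t * sample_mat_inv N M t = 1\<^sub>m M"
  by (rule mat_mult_left_right_inverse[OF _ _ sample_mat_inv_mult[OF assms]]) simp_all

lemma inv_coeff_eq:
  assumes "inj_on (\<lambda>s. exp (\<i> * complex_of_real (t s))) {1..M}"
  shows "inv_coeff N M t p k = sample_mat_inv N M t $$ (p - 1, k - 1)"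
  using mat_inverse_eqI[OF _ _ sample_mat_inv_mult[OF assms]] by (simp add: inv_coeff_def)

section \<open>The reconstruction functions\<close>

lemma recon_fun_eq_lagrange:
  assumes "inj_on (\<lambda>s. exp (\<i> * complex_of_real (t s))) {1..M}" "p \<in> {1..M}"
  shows "recon_fun N M t p x = exp (\<i> * of_int (fst N) * of_real (x - t p))
      * poly (lagrange_basis {1..M} (\<lambda>s. exp (\<i> * of_real (t s))) p) (exp (\<i> * of_real x))"
  unfolding recon_fun_def inv_coeff_eq[OF assms(1)] by (rule sum_sample_mat_inv[OF assms(2)])

text \<open>Each of the M - 1 factors of the Lagrange polynomial contributes one half-angle phase
  exp(i(x - t_p)/2); their product is the second exponential.\<close>

lemma recon_fun_closed_form:
  assumes "inj_on (\<lambda>s. exp (\<i> * complex_of_real (t s))) {1..M}" "p \<in> {1..M}"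
  shows "recon_fun N M t p x =
           exp (\<i> * of_int (fst N) * of_real (x - t p))
           * exp (\<i> * (of_nat M - 1) * of_real (x - t p) / 2)
           * of_real ((\<Prod>s \<in> {1..M} - {p}. sin ((x - t s) / 2))
                      / (\<Prod>s \<in> {1..M} - {p}. sin ((t p - t s) / 2)))"
proof -
  \<comment> \<open>Membership of \<open>p\<close> gives M \<ge> 1, so the truncated difference M -
    1 agrees with the complex one.\<close>
  have M: "of_nat (card ({1..M} - {p})) = (of_nat M - 1 :: complex)"
    using assms(2) by (simp add: of_nat_diff)
  have "exp (\<i> * complex_of_real (x - t p) / 2) ^ card ({1..M} - {p})
      = exp (\<i> * (of_nat M - 1) * of_real (x - t p) / 2)"
    unfolding exp_of_nat_mult[symmetric] M by (simp add: algebra_simps)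
  then show ?thesis
    unfolding recon_fun_eq_lagrange[OF assms] poly_lagrange_basis exp_ii_diff_divide
      prod.distrib of_real_prod[symmetric] prod_dividef prod_constant
    by simp
qed

text \<open>Reconstruction sums over sample points rather than frequencies, so it needs the entries
  of the product with the inverse on the right.\<close>

lemma sum_inv_coeff:
  assumes "inj_on (\<lambda>s. exp (\<i> * complex_of_real (t s))) {1..M}" "j \<in> {1..M}" "k \<in> {1..M}"
  shows "(\<Sum>p = 1..M. exp (\<i> * of_int (int j + fst N - 1) * of_real (t p)) * inv_coeff N M t p k)
    = (if j = k then 1 else 0)"
proof -
  have "(sample_mat N M t * sample_mat_inv N M t) $$ (j - 1, k - 1) = 1\<^sub>m M $$ (j - 1, k - 1)"
    by (simp only: sample_mat_mult_inv[OF assms(1)])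
  also have "\<dots> = (if j = k then 1 else 0)"
    using assms(2,3) by auto
  also have "(sample_mat N M t * sample_mat_inv N M t) $$ (j - 1, k - 1)
      = (\<Sum>p<M. sample_mat N M t $$ (j - 1, p) * sample_mat_inv N M t $$ (p, k - 1))"
    using assms(2,3) by (intro index_mult_mat_sum[OF sample_mat_carrier sample_mat_inv_carrier]) auto
  also have "\<dots> = (\<Sum>p = 1..M. exp (\<i> * of_int (int j + fst N - 1) * of_real (t p))
      * inv_coeff N M t p k)"
    using assms(2,3) by (intro sum.reindex_bij_witness[of _ "\<lambda>p. p - 1" Suc])
      (auto simp: inv_coeff_eq[OF assms(1)] sample_mat_def algebra_simps)
  finally show ?thesis .
qed

lemma recon_fun_exp:
  assumes "inj_on (\<lambda>s. exp (\<i> * complex_of_real (t s))) {1..M}"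
    and "fst N \<le> n" "n < fst N + int M"
  shows "(\<Sum>p = 1..M. exp (\<i> * of_int n * of_real (t p)) * recon_fun N M t p x)
    = exp (\<i> * of_int n * of_real x)"
proof -
  \<comment> \<open>The 1-based row of the sampling matrix that carries the frequency
    \<open>n\<close>.\<close>
  define j where "j = nat (n - fst N + 1)"
  have j: "j \<in> {1..M}" and n: "n = int j + fst N - 1"
    using assms(2,3) by (auto simp: j_def)
  \<comment> \<open>After the sums are interchanged, the inner sum over \<open>p\<close> is the
    Kronecker delta of \<open>j\<close> and \<open>k\<close>, which leaves the single frequency
    \<open>n\<close>.\<close>
  have "(\<Sum>p = 1..M. exp (\<i> * of_int n * of_real (t p)) * recon_fun N M t p x)
      = (\<Sum>k = 1..M. (\<Sum>p = 1..M. exp (\<i> * of_int n * of_real (t p)) * inv_coeff N M t p k)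
          * exp (\<i> * of_int (int k + fst N - 1) * of_real x))"
    unfolding recon_fun_def sum_distrib_left sum_distrib_right
    by (subst sum.swap) (simp add: mult.assoc)
  also have "\<dots> = (\<Sum>k = 1..M. if j = k
      then exp (\<i> * of_int (int k + fst N - 1) * of_real x) else 0)"
    unfolding n by (intro sum.cong refl) (simp only: sum_inv_coeff[OF assms(1) j], simp)
  also have "\<dots> = exp (\<i> * of_int n * of_real x)"
    using j by (simp add: n)
  finally show ?thesis .
qed

text \<open>By linearity it suffices to reproduce each exponential. The bound on the cardinality
  puts the whole band among the M consecutive frequencies starting at \<open>fst N\<close>.\<close>

lemma bandlimited_recon:
  assumes "inj_on (\<lambda>s. exp (\<i> * complex_of_real (t s))) {1..M}"
    and "card (freq_interval N) \<le> M" "f \<in> bandlimited N"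
  shows "f x = (\<Sum>p = 1..M. f (t p) * recon_fun N M t p x)"
proof -
  obtain a where f: "f = (\<lambda>t. \<Sum>n\<in>freq_interval N. a n * exp (\<i> * of_int n * of_real t))"
    using assms(3) by (auto simp: bandlimited_def)
  have "(\<Sum>p = 1..M. f (t p) * recon_fun N M t p x)
      = (\<Sum>n\<in>freq_interval N.
          a n * (\<Sum>p = 1..M. exp (\<i> * of_int n * of_real (t p)) * recon_fun N M t p x))"
    unfolding f sum_distrib_left sum_distrib_right by (subst sum.swap) (simp add: mult.assoc)
  also have "\<dots> = f x"
    unfolding f using assms(2)
    by (intro sum.cong refl arg_cong2[where f = "(*)"] recon_fun_exp[OF assms(1)])
      (auto simp: freq_interval_def)
  finally show ?thesis ..
qed

theorem mainTheorem3:
  fixes N :: "int \<times> int" and M :: nat and t :: "nat \<Rightarrow> real"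
  assumes "fst N \<le> snd N"
    and "M \<ge> card (freq_interval N)"
    and "strict_mono_on {1..M} t"
    and "0 \<le> t 1"
    and "t M < 2 * pi"
  shows "invertible_mat (sample_mat N M t)
    \<and> (\<forall>f \<in> bandlimited N. \<forall>x. f x = (\<Sum>p = 1..M. f (t p) * recon_fun N M t p x))
    \<and> (\<forall>p \<in> {1..M}. \<forall>x.
         recon_fun N M t p x =
           exp (\<i> * of_int (fst N) * of_real (x - t p))
           * exp (\<i> * (of_nat M - 1) * of_real (x - t p) / 2)
           * of_real ((\<Prod>s \<in> {1..M} - {p}. sin ((x - t s) / 2))
                      / (\<Prod>s \<in> {1..M} - {p}. sin ((t p - t s) / 2))))"
proof -
  \<comment> \<open>Monotonicity carries the bounds at the two end points over to all
    samples.\<close>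
  have "t s \<in> {0..<2 * pi}" if s: "s \<in> {1..M}" for s
  proof -
    have "t 1 \<le> t s" "t s \<le> t M"
      using s by (auto intro!: monotone_onD[OF strict_mono_on_imp_mono_on[OF assms(3)]])
    with assms(4,5) show ?thesis
      by simp
  qed
  then have inj: "inj_on (\<lambda>s. exp (\<i> * complex_of_real (t s))) {1..M}"
    by (intro inj_on_exp_ii strict_mono_on_imp_inj_on[OF assms(3)]) blast
  have "sample_mat N M t * sample_mat_inv N M t = 1\<^sub>m M"
    by (rule sample_mat_mult_inv[OF inj])
  then have "invertible_mat (sample_mat N M t)"
    using sample_mat_inv_mult[OF inj] carrier_matD[OF sample_mat_carrier[of N M t]]
      carrier_matD[OF sample_mat_inv_carrier[of N M t]]
    unfolding invertible_mat_def inverts_mat_def square_mat.simps by metis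
  with bandlimited_recon[OF inj assms(2)] recon_fun_closed_form[OF inj] show ?thesis
    by blast
qed

end
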